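(* In the setting described in the context, the following optimization problem (Problem 1, closest selection) is concave, i.e. it is the maximization of a concave function of $(p_1,\dots,p_N)$ under linear constraints: $$\max_{p_1,\dots,p_N}\ \sum_{i=1}^{N}q_i\sum_{m=1}^{M-L+1}(-1)^{m+1}\binom{M-L+1}{m}\int_0^D 2\pi\lambda p_i r\,e^{-\lambda p_i\pi r^2}e^{-\frac{\eta\beta m r^{\alpha_i}}{P}\sigma^2}\mathcal{L}_{\mathcal{I}_o}\!\left(\frac{\eta\beta m r^{\alpha_i}}{P}\right)\mathrm{d}r$$ subject to $\sum_{i=1}^N p_i\le N_c$ and $0\le p_i\le 1$ for all $i=1,\dots,N$.
   Context: Parameters: integers $M\ge1$, $N>N_c\ge 1$; reals $\lambda,\lambda_p,D,P,\beta>0$, $\sigma^2\ge0$, $d_g\ge 0$, pathloss exponents $0<\alpha_i<\alpha_o$ (the subscript in $\alpha_i$ is a label, unrelated to the file index $i$); a probability vector $q_1\ge\dots\ge q_N\ge 0$, $\sum_i q_i=1$. Here $p_i$ is the probability that a radio unit (RU) caches file $i$, $q_i$ the request probability of file $i$, $N_c$ the cache memory size. $L=\min\{M,\lfloor\lambda\pi D^2\rfloor\}$ and $\eta=\bigl((M-L+1)!\bigr)^{-1/(M-L+1)}$. $\mathcal{L}_{\mathcal{I}_o}(s)=\mathbb{E}\{e^{-s\mathcal{I}_o}\}$ is the Laplace transform of the nonnegative random variable $$\mathcal{I}_o=\sum_{\mathbf{x}\in\Phi_p}\sum_{\mathbf{y}\in\mathcal{A}_{\mathbf{x}}}P f_{\mathbf{y}}\|\mathbf{y}\|^{-\alpha_o},$$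 the out of cloud interference: $\Phi_p$ is a homogeneous Poisson point process on $\mathbb{R}^2$ of intensity $\lambda_p$; given $\Phi_p$, for each $\mathbf{x}\in\Phi_p$, $\Phi_{\mathbf{x}}$ is an independent homogeneous Poisson point process of intensity $\lambda$ on the disk of center $\mathbf{x}$ and radius $D$; $\mathcal{A}_{\mathbf{x}}$ consists of $\min\{M,n\}$ of the $n$ points of $\Phi_{\mathbf{x}}$ at distance more than $d_g$ from the origin, chosen uniformly at random; the $f_{\mathbf{y}}$ are i.i.d. unit-mean exponential, independent of the locations. *)

theory Defs
  imports "HOL-Probability.Probability"
begin

section \<open>Point configurations and Poisson point processes\<close>

(* Locally finite subsets of a Euclidean space, with the sigma-algebra generated by the numbers of
   points in bounded Borel sets. Simple point processes are the random elements of this space. *)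
definition configs :: "('a::euclidean_space) set measure" where
  "configs = sigma {\<phi>. \<forall>A. bounded A \<longrightarrow> finite (\<phi> \<inter> A)}
     {{\<phi>. (\<forall>B. bounded B \<longrightarrow> finite (\<phi> \<inter> B)) \<and> card (\<phi> \<inter> A) = k} | A k.
        A \<in> sets borel \<and> bounded A}"

(* Q is the law of the Poisson point process with intensity measure \<mu>, where \<mu> is assumed to be
   locally finite and diffuse. For a bounded set of measure 0 the formula below has 0 ^ 0 = 1. *)
definition poisson_law :: "('a::euclidean_space) measure \<Rightarrow> 'a set measure \<Rightarrow> bool" where
  "poisson_law \<mu> Q \<longleftrightarrow> prob_space Q \<and> sets Q = sets configs \<and>
     (\<forall>A k. A \<in> sets borel \<and> bounded A \<longrightarrow>
        measure Q {\<phi> \<in> space Q. card (\<phi> \<inter> A) = k} = measure \<mu> A ^ k / fact k * exp (- measure \<mu> A)) \<and>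
     (\<forall>A :: nat \<Rightarrow> 'a set. (\<forall>i. A i \<in> sets borel \<and> bounded (A i)) \<and> disjoint_family A \<longrightarrow>
        prob_space.indep_vars Q (\<lambda>_. count_space UNIV) (\<lambda>i \<phi>. card (\<phi> \<inter> A i)) UNIV)"

definition homogeneous :: "real \<Rightarrow> ('a::euclidean_space) set \<Rightarrow> 'a measure" where
  "homogeneous c S = density lborel (\<lambda>x. ennreal c * indicator S x)"

section \<open>Conditional laws\<close>

(* Given the sub-sigma-algebra F, the variables Y 0, Y 1, ... are independent and Y j has the
   regular conditional distribution \<kappa> j. *)
definition cond_indep_laws ::
  "'w measure \<Rightarrow> 'w measure \<Rightarrow> 'b measure \<Rightarrow> (nat \<Rightarrow> 'w \<Rightarrow> 'b) \<Rightarrow> (nat \<Rightarrow> 'w \<Rightarrow> 'b measure) \<Rightarrow> bool" where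
  "cond_indep_laws W F N Y \<kappa> \<longleftrightarrow>
     (\<forall>j. Y j \<in> measurable W N \<and> \<kappa> j \<in> measurable F (prob_algebra N)) \<and>
     (\<forall>J E U. finite J \<and> E \<in> sets F \<and> (\<forall>j\<in>J. U j \<in> sets N) \<longrightarrow>
        measure W {\<omega> \<in> E. \<forall>j\<in>J. Y j \<omega> \<in> U j} =
        (\<integral>\<omega>. indicator E \<omega> * (\<Prod>j\<in>J. measure (\<kappa> j \<omega>) (U j)) \<partial>W))"

definition selections :: "nat \<Rightarrow> 'a set \<Rightarrow> 'a set set" where
  "selections M S = {B. B \<subseteq> S \<and> finite B \<and> card B = min M (card S)}"

section \<open>Out of cloud interference\<close>

type_synonym plane = "real ^ 2"

(* X enumerates the points of the parent process Parents, Cl n is the cluster of X n, and A n is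
   its selected part. The points of A n are listed as Y n 0, ..., Y n (card (A n) - 1), and H n k
   is the fading coefficient f_y of the point y = Y n k. *)
locale out_of_cloud = prob_space W for W :: "'w measure" +
  fixes M :: nat and lam lam_p D dg :: real
    and Parents :: "'w \<Rightarrow> plane set"
    and X :: "nat \<Rightarrow> 'w \<Rightarrow> plane"
    and Cl :: "nat \<Rightarrow> 'w \<Rightarrow> plane set"
    and A :: "nat \<Rightarrow> 'w \<Rightarrow> plane set"
    and Y :: "nat \<Rightarrow> nat \<Rightarrow> 'w \<Rightarrow> plane"
    and H :: "nat \<Rightarrow> nat \<Rightarrow> 'w \<Rightarrow> real"
  assumes parents_measurable: "Parents \<in> measurable W configs"
    and parents_poisson: "poisson_law (homogeneous lam_p UNIV) (distr W configs Parents)"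
    and X_measurable: "\<And>n. X n \<in> borel_measurable W"
    and X_enumerates: "AE \<omega> in W. bij_betw (\<lambda>n. X n \<omega>) UNIV (Parents \<omega>)"
    and clusters_poisson:
      "\<exists>\<kappa>. cond_indep_laws W
             (vimage_algebra (space W) (\<lambda>\<omega> n. X n \<omega>) (\<Pi>\<^sub>M n\<in>UNIV. borel))
             configs Cl \<kappa> \<and>
           (\<forall>n. \<forall>\<omega>\<in>space W. poisson_law (homogeneous lam (cball (X n \<omega>) D)) (\<kappa> n \<omega>))"
    and selection_uniform:
      "\<exists>\<kappa>. cond_indep_laws W
             (vimage_algebra (space W) (\<lambda>\<omega> n. (X n \<omega>, Cl n \<omega>))
                (\<Pi>\<^sub>M n\<in>UNIV. borel \<Otimes>\<^sub>M configs))
             configs A \<kappa> \<and>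
           (\<forall>n. \<forall>\<omega>\<in>space W. \<forall>U\<in>sets configs. measure (\<kappa> n \<omega>) U =
              measure_pmf.prob (pmf_of_set (selections M {y \<in> Cl n \<omega>. norm y > dg})) U)"
    and Y_measurable: "\<And>n k. Y n k \<in> borel_measurable W"
    and Y_enumerates: "\<And>n. AE \<omega> in W. bij_betw (\<lambda>k. Y n k \<omega>) {..<card (A n \<omega>)} (A n \<omega>)"
    and fading_exponential: "\<And>n k. distributed W lborel (H n k) (exponential_density 1)"
    and fading_indep: "indep_vars (\<lambda>_. borel) (\<lambda>(n, k). H n k) UNIV"
    and fading_indep_locations:
      "indep_set
         (sets (vimage_algebra (space W) (\<lambda>\<omega> (n, k). H n k \<omega>) (\<Pi>\<^sub>M i\<in>UNIV. borel)))
         (sets (vimage_algebra (space W) (\<lambda>\<omega> n. (X n \<omega>, Cl n \<omega>, A n \<omega>, (\<lambda>k. Y n k \<omega>)))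
            (\<Pi>\<^sub>M n\<in>UNIV. borel \<Otimes>\<^sub>M configs \<Otimes>\<^sub>M configs \<Otimes>\<^sub>M (\<Pi>\<^sub>M k\<in>UNIV. borel))))"

(* The value may be \<infinity>, for example almost surely if \<alpha>\<^sub>o \<le> 2. *)
definition interference ::
  "real \<Rightarrow> real \<Rightarrow> (nat \<Rightarrow> 'w \<Rightarrow> plane set) \<Rightarrow> (nat \<Rightarrow> nat \<Rightarrow> 'w \<Rightarrow> plane) \<Rightarrow>
   (nat \<Rightarrow> nat \<Rightarrow> 'w \<Rightarrow> real) \<Rightarrow> 'w \<Rightarrow> ennreal" where
  "interference P \<alpha>\<^sub>o A Y H \<omega> =
     (\<Sum>n. \<Sum>k<card (A n \<omega>). ennreal (P * H n k \<omega> * norm (Y n k \<omega>) powr (- \<alpha>\<^sub>o)))"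

(* E[exp (- s I)] for s \<ge> 0, with exp (- \<infinity>) = 0. *)
definition laplace :: "'w measure \<Rightarrow> ('w \<Rightarrow> ennreal) \<Rightarrow> real \<Rightarrow> real" where
  "laplace W I s =
     (\<integral>\<omega>. (if ennreal s * I \<omega> = \<infinity> then 0 else exp (- enn2real (ennreal s * I \<omega>))) \<partial>W)"

section \<open>The optimization problem\<close>

definition num_serving :: "nat \<Rightarrow> real \<Rightarrow> real \<Rightarrow> nat" where
  "num_serving M lam D = min M (nat \<lfloor>lam * pi * D\<^sup>2\<rfloor>)"

definition eta :: "nat \<Rightarrow> nat \<Rightarrow> real" where
  "eta M L = fact (M - L + 1) powr (- 1 / real (M - L + 1))"

definition objective ::
  "nat \<Rightarrow> nat \<Rightarrow> real \<Rightarrow> real \<Rightarrow> real \<Rightarrow> real \<Rightarrow> real \<Rightarrow> real \<Rightarrow> (real \<Rightarrow> real) \<Rightarrow>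
   real ^ 'n \<Rightarrow> real ^ 'n \<Rightarrow> real" where
  "objective M L lam D P \<beta> sigma2 \<alpha>\<^sub>i Lap q p =
     (\<Sum>i\<in>UNIV. q $ i * (\<Sum>m = 1..M - L + 1.
        (- 1) ^ (m + 1) * real ((M - L + 1) choose m) *
        (LINT r:{0..D}|lborel.
           2 * pi * lam * p $ i * r * exp (- lam * p $ i * pi * r\<^sup>2) *
           exp (- (eta M L * \<beta> * real m * r powr \<alpha>\<^sub>i / P) * sigma2) *
           Lap (eta M L * \<beta> * real m * r powr \<alpha>\<^sub>i / P))))"

definition feasible_set :: "nat \<Rightarrow> (real ^ 'n) set" where
  "feasible_set N\<^sub>c = {p. (\<Sum>i\<in>UNIV. p $ i) \<le> real N\<^sub>c \<and> (\<forall>i. 0 \<le> p $ i \<and> p $ i \<le> 1)}"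

(* Maximization of f over S, with f concave and S given by finitely many linear inequalities. *)
definition concave_program :: "('a::euclidean_space \<Rightarrow> real) \<Rightarrow> 'a set \<Rightarrow> bool" where
  "concave_program f S \<longleftrightarrow> concave_on UNIV f \<and> polyhedron S"

end

theory Submission
  imports Defs
begin

text \<open>With \<open>n = M - L + 1\<close>, \<open>s = \<eta> \<beta> r\<^sup>\<alpha> / P\<close> and \<open>Z = exp (- s (\<sigma>\<^sup>2 + I))\<close>, the alternating sum
  over \<open>m\<close> multiplying the density of the distance to the closest point is
  \<open>G r = E[1 - (1 - Z)\<^sup>n]\<close> by the binomial theorem. As \<open>Z \<in> [0, 1]\<close> decreases in \<open>r\<close>, so does \<open>G\<close>,
  and \<open>G \<ge> 0\<close>. The density \<open>f p r = 2 \<pi> \<lambda> p r exp (- \<lambda> p \<pi> r\<^sup>2)\<close> has the primitive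
  \<open>1 - exp (- \<lambda> p \<pi> r\<^sup>2)\<close>, which is concave in \<open>p\<close>. By the second mean value theorem, integrating
  against a nonnegative decreasing \<open>G\<close> preserves nonnegativity of a primitive, so \<open>\<integral> f p r G r dr\<close> is
  concave in \<open>p\<close>.\<close>

section \<open>Integrals against decreasing weights\<close>

text \<open>A monotone function is Borel, and on a compact interval it lies between its two endpoint
  values, so the product is dominated by a continuous function. Weights built from Laplace
  transforms are handled through their monotonicity in this way.\<close>

lemma set_integrable_continuous_mult_antimono:
  fixes f g :: "real \<Rightarrow> real"
  assumes f: "continuous_on {a..b} f" and g: "antimono_on {a..b} g"
  shows "set_integrable lborel {a..b} (\<lambda>x. f x * g x)"
proof -
  have "(\<lambda>x. - g x) \<in> borel_measurable (restrict_space borel {a..b})"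
    using g by (intro borel_measurable_mono_on_fnc) (auto simp: monotone_on_def)
  then have [measurable]: "g \<in> borel_measurable (restrict_space borel {a..b})"
    by simp
  have [measurable]: "f \<in> borel_measurable (restrict_space borel {a..b})"
    using f by (rule borel_measurable_continuous_on_restrict)
  have "(\<lambda>x. f x * g x) \<in> borel_measurable (restrict_space borel {a..b})"
    by measurable
  then have meas: "set_borel_measurable lborel {a..b} (\<lambda>x. f x * g x)"
    by (simp add: set_borel_measurable_def borel_measurable_restrict_space_iff)
  have "set_integrable lborel {a..b} (\<lambda>x. f x * (\<bar>g a\<bar> + \<bar>g b\<bar>))"
    by (intro borel_integrable_atLeastAtMost' continuous_intros f)
  moreover have "norm (f x * g x) \<le> norm (f x * (\<bar>g a\<bar> + \<bar>g b\<bar>))" if "x \<in> {a..b}" for x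
  proof -
    have "g b \<le> g x" "g x \<le> g a"
      using g that by (auto simp: monotone_on_def)
    then have "\<bar>g x\<bar> \<le> \<bar>g a\<bar> + \<bar>g b\<bar>"
      by linarith
    then show ?thesis
      by (simp add: abs_mult mult_left_mono)
  qed
  ultimately show ?thesis
    using meas by (blast intro: set_integrable_bound AE_I2)
qed

text \<open>The second mean value theorem writes the integral as a combination of two values of the
  primitive of \<open>f\<close>, with coefficients \<open>g a - g b\<close> and \<open>g b\<close>,
  both nonnegative.\<close>

lemma integral_nonneg_mult_antimono:
  fixes f g :: "real \<Rightarrow> real"
  assumes "a \<le> b" and f: "f integrable_on {a..b}"
    and prim: "\<And>c. c \<in> {a..b} \<Longrightarrow> 0 \<le> integral {a..c} f"
    and g: "antimono_on {a..b} g" and "0 \<le> g b"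
  shows "0 \<le> integral {a..b} (\<lambda>x. f x * g x)"
proof -
  \<comment> \<open>The mean value theorem is applied to an increasing weight, hence to
    \<open>- g\<close>.\<close>
  obtain c where c: "c \<in> {a..b}"
    "integral {a..b} (\<lambda>x. - g x * f x) = - g a * integral {a..c} f + - g b * integral {c..b} f"
    using second_mean_value_theorem[OF f \<open>a \<le> b\<close>, of "\<lambda>x. - g x"] g
    by (auto simp: monotone_on_def)
  \<comment> \<open>Eliminating the integral over \<open>{c..b}\<close> leaves only integrals that
    start at \<open>a\<close>, the ones controlled by \<open>prim\<close>.\<close>
  have "integral {a..b} f = integral {a..c} f + integral {c..b} f"
    using Henstock_Kurzweil_Integration.integral_combine[of a c b f] c f by auto
  then have "integral {a..b} (\<lambda>x. f x * g x)
      = (g a - g b) * integral {a..c} f + g b * integral {a..b} f"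
    using c by (simp add: algebra_simps)
  moreover have "g b \<le> g a"
    using g \<open>a \<le> b\<close> by (auto simp: monotone_on_def)
  ultimately show ?thesis
    using prim[OF \<open>c \<in> {a..b}\<close>] prim[of b] \<open>a \<le> b\<close> \<open>0 \<le> g b\<close> by simp
qed

text \<open>For fixed \<open>r\<close> the integrand need not be concave in \<open>p\<close>. Its
  primitive in \<open>r\<close> is, being 1 minus the exponential of a function linear in
  \<open>p\<close>, and a nonnegative decreasing weight transfers this to the integral.\<close>

lemma concave_on_rayleigh_integral:
  fixes G :: "real \<Rightarrow> real"
  assumes "0 \<le> D" and G: "antimono_on {0..D} G" and "0 \<le> G D"
  shows "concave_on UNIV
    (\<lambda>p. LINT r:{0..D}|lborel. 2 * pi * lam * p * r * exp (- lam * p * pi * r\<^sup>2) * G r)"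
proof -
  define f where "f = (\<lambda>p r. 2 * pi * lam * p * r * exp (- lam * p * pi * r\<^sup>2))"
  define F where "F = (\<lambda>p r. 1 - exp (- lam * p * pi * r\<^sup>2))"
  have f_integral: "(f p has_integral F p c) {0..c}" if "0 \<le> c" for p c
  proof -
    have "(F p has_vector_derivative f p r) (at r within {0..c})" for r
      unfolding F_def f_def
      by (auto intro!: derivative_eq_intros
          simp flip: has_real_derivative_iff_has_vector_derivative)
    then have "(f p has_integral F p c - F p 0) {0..c}"
      using that by (intro fundamental_theorem_of_calculus)
    then show ?thesis
      by (simp add: F_def)
  qed
  have F_concave: "u * F x r + v * F y r \<le> F (u * x + v * y) r"
    if "0 \<le> u" "0 \<le> v" "u + v = 1" for u v x y r
  proof -
    have "exp (u *\<^sub>R (- lam * x * pi * r\<^sup>2) + v *\<^sub>R (- lam * y * pi * r\<^sup>2))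
        \<le> u * exp (- lam * x * pi * r\<^sup>2) + v * exp (- lam * y * pi * r\<^sup>2)"
      using exp_convex that unfolding convex_on_def by blast
    moreover have "u *\<^sub>R (- lam * x * pi * r\<^sup>2) + v *\<^sub>R (- lam * y * pi * r\<^sup>2)
        = - lam * (u * x + v * y) * pi * r\<^sup>2"
      by (simp add: algebra_simps)
    ultimately show ?thesis
      using that(3) by (simp add: F_def algebra_simps)
  qed
  have int: "set_integrable lborel {0..D} (\<lambda>r. f p r * G r)" for p
    by (intro set_integrable_continuous_mult_antimono G)
      (auto simp: f_def intro!: continuous_intros)
  \<comment> \<open>The mean value argument concerns Henstock-Kurzweil integrals, so the Lebesgue
    integrals are translated.\<close>
  note HK = set_borel_integral_eq_integral[OF int]
  have "u * (LINT r:{0..D}|lborel. f x r * G r) + v * (LINT r:{0..D}|lborel. f y r * G r)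
      \<le> (LINT r:{0..D}|lborel. f (u * x + v * y) r * G r)"
    if uv: "0 \<le> u" "0 \<le> v" "u + v = 1" for u v x y
  proof -
    \<comment> \<open>The primitive of \<open>d\<close> vanishing at 0 is the gap in the concavity
      inequality for \<open>F\<close>, hence nonnegative.\<close>
    define d where "d = (\<lambda>r. f (u * x + v * y) r - (u * f x r + v * f y r))"
    have d: "(d has_integral F (u * x + v * y) c - (u * F x c + v * F y c)) {0..c}"
      if "0 \<le> c" for c
      unfolding d_def using that
      by (intro has_integral_diff has_integral_add has_integral_mult_right f_integral)
    have "0 \<le> integral {0..D} (\<lambda>r. d r * G r)"
    proof (rule integral_nonneg_mult_antimono)
      show "d integrable_on {0..D}"
        using d[OF \<open>0 \<le> D\<close>] by blast
      show "0 \<le> integral {0..c} d" if "c \<in> {0..D}" for c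
        using F_concave[OF uv, of x c y] integral_unique[OF d, of c] that by simp
    qed (use assms in auto)
    also have "(\<lambda>r. d r * G r)
        = (\<lambda>r. f (u * x + v * y) r * G r - (u * (f x r * G r) + v * (f y r * G r)))"
      by (auto simp: d_def algebra_simps)
    also have "integral {0..D} \<dots> = integral {0..D} (\<lambda>r. f (u * x + v * y) r * G r)
        - (u * integral {0..D} (\<lambda>r. f x r * G r) + v * integral {0..D} (\<lambda>r. f y r * G r))"
      by (intro integral_unique has_integral_diff has_integral_add has_integral_mult_right
          integrable_integral HK(1))
    finally show ?thesis
      by (simp add: HK(2))
  qed
  then show ?thesis
    unfolding concave_on_iff f_def by simp
qed

section \<open>The Laplace transform as the mean of a pointwise kernel\<close>

text \<open>The integrand of \<open>laplace\<close> as a function of the interference value, so that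
  monotonicity and powers can be treated before taking expectations.\<close>

definition laplace_kernel :: "real \<Rightarrow> ennreal \<Rightarrow> real" where
  "laplace_kernel s x = (if ennreal s * x = \<infinity> then 0 else exp (- enn2real (ennreal s * x)))"

lemma laplace_eq: "laplace W I s = (\<integral>\<omega>. laplace_kernel s (I \<omega>) \<partial>W)"
  by (simp add: laplace_def laplace_kernel_def)

lemma laplace_kernel_bounds: "0 \<le> laplace_kernel s x" "laplace_kernel s x \<le> 1"
  by (auto simp: laplace_kernel_def)

text \<open>\<open>ennreal\<close> is monotone on all reals, sending negative arguments to 0; an
  infinite product on the larger side gives the kernel value 0.\<close>

lemma laplace_kernel_antimono:
  assumes "s \<le> t"
  shows "laplace_kernel t x \<le> laplace_kernel s x"
proof -
  have le: "ennreal s * x \<le> ennreal t * x"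
    using assms by (intro mult_right_mono ennreal_leI) auto
  show ?thesis
  proof (cases "ennreal t * x = \<infinity>")
    case False
    with le have "ennreal s * x \<noteq> \<infinity>" "enn2real (ennreal s * x) \<le> enn2real (ennreal t * x)"
      by (auto simp: enn2real_mono less_top top_unique)
    with False show ?thesis
      by (simp add: laplace_kernel_def)
  qed (simp add: laplace_kernel_def)
qed

text \<open>This turns the Laplace transform at \<open>real m * s\<close> into the
  \<open>m\<close>-th moment of one random variable. For positive \<open>m\<close> both products are
  infinite together, and then both sides are 0.\<close>

lemma laplace_kernel_power:
  assumes "0 \<le> s" "0 < m"
  shows "laplace_kernel (real m * s) x = laplace_kernel s x ^ m"
proof -
  have "ennreal (real m * s) * x = of_nat m * (ennreal s * x)"
    using assms by (simp add: ennreal_mult ennreal_of_nat_eq_real_of_nat mult.assoc)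
  moreover have "enn2real (of_nat m * y) = real m * enn2real y" for y :: ennreal
    by (simp add: enn2real_mult)
  ultimately show ?thesis
    using assms by (auto simp: laplace_kernel_def ennreal_mult_eq_top_iff simp flip: exp_of_nat_mult)
qed

lemma laplace_kernel_measurable [measurable]: "laplace_kernel s \<in> borel_measurable borel"
  unfolding laplace_kernel_def by measurable

section \<open>The alternating sum as an expectation\<close>

lemma binomial_complement:
  fixes z :: "'a::comm_ring_1"
  shows "(\<Sum>m = 1..n. (- 1) ^ (m + 1) * of_nat (n choose m) * z ^ m) = 1 - (1 - z) ^ n"
proof -
  have "(1 - z) ^ n = (\<Sum>m\<le>n. of_nat (n choose m) * (- z) ^ m)"
    using binomial_ring[of "- z" 1 n] by simp
  \<comment> \<open>The term of index 0, absent from the alternating sum, supplies the 1.\<close>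
  also have "\<dots> = 1 + (\<Sum>m = 1..n. of_nat (n choose m) * (- z) ^ m)"
    by (simp add: sum.atMost_shift atLeast0LessThan sum.atLeast1_atMost_eq)
  also have "(\<Sum>m = 1..n. of_nat (n choose m) * (- z) ^ m)
      = - (\<Sum>m = 1..n. (- 1) ^ (m + 1) * of_nat (n choose m) * z ^ m)"
    unfolding sum_negf[symmetric] by (intro sum.cong) (auto simp: power_minus[of z])
  finally show ?thesis
    by simp
qed

text \<open>Both exponential factors at \<open>real m * s\<close> are \<open>m\<close>-th powers of
  their counterparts at \<open>s\<close>, so linearity of expectation and the binomial theorem apply
  to their product.\<close>

lemma alternating_laplace_sum:
  fixes I :: "'w \<Rightarrow> ennreal"
  assumes "prob_space W" and I [measurable]: "I \<in> borel_measurable W" and "0 \<le> s"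
  shows "(\<Sum>m = 1..n. (- 1) ^ (m + 1) * real (n choose m) *
            (exp (- (real m * s) * c) * laplace W I (real m * s)))
      = (\<integral>\<omega>. 1 - (1 - exp (- s * c) * laplace_kernel s (I \<omega>)) ^ n \<partial>W)"
proof -
  interpret prob_space W by fact
  let ?z = "\<lambda>\<omega>. exp (- s * c) * laplace_kernel s (I \<omega>)"
  have int: "integrable W (\<lambda>\<omega>. laplace_kernel s (I \<omega>) ^ m)" for m
    by (rule integrable_const_bound[of _ 1])
      (auto simp: power_le_one laplace_kernel_bounds)
  have "(\<integral>\<omega>. 1 - (1 - ?z \<omega>) ^ n \<partial>W)
      = (\<integral>\<omega>. (\<Sum>m = 1..n. (- 1) ^ (m + 1) * real (n choose m) * ?z \<omega> ^ m) \<partial>W)"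
    by (simp only: binomial_complement)
  also have "\<dots> = (\<Sum>m = 1..n. \<integral>\<omega>. (- 1) ^ (m + 1) * real (n choose m) * ?z \<omega> ^ m \<partial>W)"
    using int by (intro Bochner_Integration.integral_sum) (simp add: power_mult_distrib)
  also have "\<dots> = (\<Sum>m = 1..n. (- 1) ^ (m + 1) * real (n choose m) *
            (exp (- (real m * s) * c) * laplace W I (real m * s)))"
  proof (intro sum.cong refl)
    fix m assume "m \<in> {1..n}"
    then have "laplace W I (real m * s) = (\<integral>\<omega>. laplace_kernel s (I \<omega>) ^ m \<partial>W)"
      using \<open>0 \<le> s\<close> by (simp add: laplace_eq laplace_kernel_power)
    moreover have "exp (- s * c) ^ m = exp (- (real m * s) * c)"
      by (simp add: mult.assoc flip: exp_of_nat_mult)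
    ultimately show "(\<integral>\<omega>. (- 1) ^ (m + 1) * real (n choose m) * ?z \<omega> ^ m \<partial>W)
        = (- 1) ^ (m + 1) * real (n choose m) *
            (exp (- (real m * s) * c) * laplace W I (real m * s))"
      by (simp add: power_mult_distrib)
  qed
  finally show ?thesis ..
qed

text \<open>The number \<open>1 - (1 - z) ^ n\<close> is the chance that at least one of
  \<open>n\<close> independent events of probability \<open>z\<close> occurs: it is nonnegative and
  increasing in \<open>z\<close>, while \<open>z\<close> decreases in \<open>s\<close>.\<close>

lemma
  fixes I :: "'w \<Rightarrow> ennreal" and n :: nat
  assumes "prob_space W" and I [measurable]: "I \<in> borel_measurable W" and c: "0 \<le> c"
  defines "g \<equiv> \<lambda>s. \<integral>\<omega>. 1 - (1 - exp (- s * c) * laplace_kernel s (I \<omega>)) ^ n \<partial>W"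
  shows outage_complement_nonneg: "0 \<le> s \<Longrightarrow> 0 \<le> g s"
    and outage_complement_antimono: "0 \<le> s \<Longrightarrow> s \<le> t \<Longrightarrow> g t \<le> g s"
proof -
  interpret prob_space W by fact
  define z where "z = (\<lambda>s \<omega>. exp (- s * c) * laplace_kernel s (I \<omega>))"
  have g: "g s = (\<integral>\<omega>. 1 - (1 - z s \<omega>) ^ n \<partial>W)" for s
    by (simp add: g_def z_def)
  have [measurable]: "z s \<in> borel_measurable W" for s
    unfolding z_def by measurable
  have z: "0 \<le> z s \<omega>" "z s \<omega> \<le> 1" if "0 \<le> s" for s \<omega>
    using that c by (auto simp: z_def laplace_kernel_bounds intro!: mult_le_one)
  have pw: "0 \<le> (1 - z s \<omega>) ^ n" "(1 - z s \<omega>) ^ n \<le> 1" if "0 \<le> s" for s \<omega>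
    using z[OF that, of \<omega>] by (auto intro: power_le_one)
  have int: "integrable W (\<lambda>\<omega>. 1 - (1 - z s \<omega>) ^ n)" if "0 \<le> s" for s
    using pw[OF that] by (intro integrable_const_bound[of _ 1]) auto
  show "0 \<le> g s" if "0 \<le> s"
    unfolding g using pw[OF that] by (intro integral_nonneg_AE) auto
  show "g t \<le> g s" if "0 \<le> s" "s \<le> t"
    unfolding g
  proof (rule integral_mono)
    show "1 - (1 - z t \<omega>) ^ n \<le> 1 - (1 - z s \<omega>) ^ n" for \<omega>
    proof -
      have "z t \<omega> \<le> z s \<omega>"
        using that c unfolding z_def
        by (intro mult_mono) (auto simp: laplace_kernel_bounds laplace_kernel_antimono mult_right_mono)
      then show ?thesis
        using z[of s \<omega>] that by (auto intro!: power_mono)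
    qed
  qed (use int that in auto)
qed

text \<open>Serves to integrate each term of the alternating sum separately, as the objective
  does.\<close>

lemma laplace_antimono:
  assumes "prob_space W" and I [measurable]: "I \<in> borel_measurable W" and "s \<le> t"
  shows "laplace W I t \<le> laplace W I s"
proof -
  interpret prob_space W by fact
  have "integrable W (\<lambda>\<omega>. laplace_kernel u (I \<omega>))" for u
    by (intro integrable_const_bound[of _ 1]) (auto simp: laplace_kernel_bounds)
  with \<open>s \<le> t\<close> show ?thesis
    unfolding laplace_eq by (intro integral_mono laplace_kernel_antimono)
qed

section \<open>Measurability of the interference\<close>

lemma space_configs: "space configs = {\<phi>. \<forall>A. bounded A \<longrightarrow> finite (\<phi> \<inter> A)}"
  unfolding configs_def by (rule space_measure_of) auto

lemma card_Int_configs_measurable: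
  assumes "A \<in> sets borel" "bounded A"
  shows "(\<lambda>\<phi>. card (\<phi> \<inter> A)) \<in> measurable configs (count_space UNIV)"
proof -
  have "{\<phi> \<in> space configs. card (\<phi> \<inter> A) = k} \<in> sets configs" for k
    unfolding space_configs using assms
    by (subst configs_def, subst sets_measure_of) (auto intro!: sigma_sets.Basic)
  then show ?thesis
    by (subst measurable_count_space_eq2_countable) (auto simp: vimage_def Int_def conj_commute)
qed

text \<open>Counts in growing balls become constant exactly when all points lie in one ball. The
  case \<open>k = 0\<close> is excluded because \<open>card\<close> is also 0 on infinite sets,
  whose counts in balls do not settle at 0.\<close>

lemma card_eq_iff_card_Int_cball:
  fixes \<phi> :: "'a::euclidean_space set"
  assumes "\<phi> \<in> space configs" "0 < k"
  shows "card \<phi> = k \<longleftrightarrow> (\<exists>i. \<forall>j\<ge>i. card (\<phi> \<inter> cball 0 (real j)) = k)"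
proof
  assume k: "card \<phi> = k"
  with \<open>0 < k\<close> have "finite \<phi>"
    using card_gt_0_iff by blast
  then obtain b where "\<forall>x\<in>\<phi>. norm x \<le> b"
    using finite_imp_bounded bounded_iff by blast
  moreover obtain i where "b \<le> real i"
    using real_arch_simple by blast
  ultimately have "\<phi> \<inter> cball 0 (real j) = \<phi>" if "i \<le> j" for j
    using that by (force simp: dist_norm)
  with k show "\<exists>i. \<forall>j\<ge>i. card (\<phi> \<inter> cball 0 (real j)) = k"
    by metis
next
  assume "\<exists>i. \<forall>j\<ge>i. card (\<phi> \<inter> cball 0 (real j)) = k"
  then obtain i where i: "\<And>j. i \<le> j \<Longrightarrow> card (\<phi> \<inter> cball 0 (real j)) = k"
    by blast
  have fin: "finite (\<phi> \<inter> cball 0 r)" for r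
    using assms(1) by (simp add: space_configs)
  have "\<phi> \<subseteq> cball 0 (real i)"
  proof
    fix x assume "x \<in> \<phi>"
    obtain j where j: "norm x \<le> real j"
      using real_arch_simple by blast
    \<comment> \<open>Nested finite sets of equal cardinality coincide, so the larger ball contains
      no further point.\<close>
    have "\<phi> \<inter> cball 0 (real i) = \<phi> \<inter> cball 0 (real (max i j))"
      using fin i[of i] i[of "max i j"] by (intro card_subset_eq) auto
    with \<open>x \<in> \<phi>\<close> j show "x \<in> cball 0 (real i)"
      by (auto simp: dist_norm)
  qed
  then show "card \<phi> = k"
    using i[of i] by (simp add: Int_absorb2)
qed

text \<open>The sigma-algebra is generated by counts in bounded sets only, so the total count is
  recovered from a sequence of balls.\<close>

lemma card_configs_measurable: "(card :: 'a::euclidean_space set \<Rightarrow> nat) \<in> measurable configs (count_space UNIV)"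
proof -
  have [measurable]: "(\<lambda>\<phi> :: 'a set. card (\<phi> \<inter> cball 0 (real j))) \<in> measurable configs (count_space UNIV)"
    for j
    by (intro card_Int_configs_measurable) auto
  have pos: "{\<phi> :: 'a set \<in> space configs. card \<phi> = k} \<in> sets configs" if "0 < k" for k
  proof -
    have "{\<phi> :: 'a set \<in> space configs. card \<phi> = k}
        = {\<phi> \<in> space configs. \<exists>i. \<forall>j\<in>{i..}. card (\<phi> \<inter> cball 0 (real j)) = k}"
    proof (intro Collect_cong conj_cong refl)
      show "card \<phi> = k \<longleftrightarrow> (\<exists>i. \<forall>j\<in>{i..}. card (\<phi> \<inter> cball 0 (real j)) = k)"
        if "\<phi> \<in> space configs" for \<phi> :: "'a set"
        unfolding Ball_def atLeast_iff using that \<open>0 < k\<close> by (rule card_eq_iff_card_Int_cball)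
    qed
    also have "\<dots> \<in> sets configs"
      by measurable
    finally show ?thesis .
  qed
  \<comment> \<open>This event contains the empty and all infinite configurations; it is reached as
    the complement of the positive counts.\<close>
  have "{\<phi> :: 'a set \<in> space configs. card \<phi> = 0}
      = space configs - (\<Union>k. {\<phi> \<in> space configs. card \<phi> = Suc k})"
    using not0_implies_Suc by fastforce
  also have "\<dots> \<in> sets configs"
    using pos by (intro sets.Diff sets.countable_UN) auto
  finally have "{\<phi> :: 'a set \<in> space configs. card \<phi> = k} \<in> sets configs" for k
    using pos by (cases k) auto
  then show ?thesis
    by (subst measurable_count_space_eq2_countable) (auto simp: vimage_def Int_def conj_commute)
qed

lemma (in out_of_cloud) interference_measurable:
  "interference P \<alpha>\<^sub>o A Y H \<in> borel_measurable W"
proof -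
  have A: "A n \<in> measurable W configs" for n
    using selection_uniform unfolding cond_indep_laws_def by blast
  have [measurable]: "(\<lambda>\<omega>. card (A n \<omega>)) \<in> measurable W (count_space UNIV)" for n
    using measurable_compose[OF A card_configs_measurable] .
  have [measurable]: "H n k \<in> borel_measurable W" for n k
    using distributed_measurable[OF fading_exponential, of n k] by simp
  note Y_measurable [measurable]
  \<comment> \<open>A sum of random length becomes a full series of measurable terms, each cut off
    by an event on the count.\<close>
  have "(\<Sum>k<card (A n \<omega>). ennreal (P * H n k \<omega> * norm (Y n k \<omega>) powr (- \<alpha>\<^sub>o)))
      = (\<Sum>k. if k < card (A n \<omega>)
            then ennreal (P * H n k \<omega> * norm (Y n k \<omega>) powr (- \<alpha>\<^sub>o)) else 0)" for n \<omega>
    by (subst suminf_finite[of "{..<card (A n \<omega>)}"]) auto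
  then have "interference P \<alpha>\<^sub>o A Y H = (\<lambda>\<omega>. \<Sum>n. \<Sum>k. if k < card (A n \<omega>)
      then ennreal (P * H n k \<omega> * norm (Y n k \<omega>) powr (- \<alpha>\<^sub>o)) else 0)"
    by (simp add: interference_def fun_eq_iff)
  also have "\<dots> \<in> borel_measurable W"
    by measurable
  finally show ?thesis .
qed

section \<open>The feasible set and the objective\<close>

lemma polyhedron_feasible_set: "polyhedron (feasible_set N :: (real ^ 'n) set)"
proof -
  \<comment> \<open>The vector \<open>1\<close> has all entries 1, so its inner product with
    \<open>p\<close> is the coordinate sum.\<close>
  have "(feasible_set N :: (real ^ 'n) set) = {p. (1 :: real ^ 'n) \<bullet> p \<le> real N} \<inter> cbox 0 1"
    by (auto simp: feasible_set_def inner_vec_def mem_box_cart)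
  then show ?thesis
    by (simp add: polyhedron_halfspace_le polytope_imp_polyhedron polytope_interval)
qed

lemma concave_on_sum_components:
  fixes g :: "real \<Rightarrow> real" and q :: "real ^ 'n"
  assumes g: "concave_on UNIV g" and q: "\<And>i. 0 \<le> q $ i"
  shows "concave_on UNIV (\<lambda>p. \<Sum>i\<in>UNIV. q $ i * g (p $ i))"
proof -
  have "u * (q $ i * g (x $ i)) + v * (q $ i * g (y $ i)) \<le> q $ i * g (u * x $ i + v * y $ i)"
    if "0 \<le> u" "0 \<le> v" "u + v = 1" for u v x y i
  proof -
    have "u * g (x $ i) + v * g (y $ i) \<le> g (u * x $ i + v * y $ i)"
      using g that by (simp add: concave_on_iff)
    from mult_left_mono[OF this q[of i]] show ?thesis
      by (simp add: algebra_simps)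
  qed
  then show ?thesis
    by (auto simp: concave_on_iff sum_distrib_left simp flip: sum.distrib intro!: sum_mono)
qed

text \<open>The terms over \<open>m\<close> have alternating signs, so concavity is obtained only
  after they are collected into the single weight \<open>G\<close>. The objective is then a sum of
  functions of one coordinate each, with nonnegative weights \<open>q\<close>.\<close>

lemma concave_on_objective:
  fixes I :: "'w \<Rightarrow> ennreal" and q :: "real ^ 'n"
  assumes "prob_space W" and I: "I \<in> borel_measurable W"
    and "0 \<le> D" "0 < P" "0 \<le> \<beta>" "0 \<le> sigma2" "0 \<le> \<alpha>\<^sub>i" and q: "\<And>i. 0 \<le> q $ i"
  shows "concave_on UNIV (objective M L lam D P \<beta> sigma2 \<alpha>\<^sub>i (laplace W I) q)"
proof -
  define n where "n = M - L + 1"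
  define s where "s = (\<lambda>r. eta M L * \<beta> / P * r powr \<alpha>\<^sub>i)"
  define f where "f = (\<lambda>p r. 2 * pi * lam * p * r * exp (- lam * p * pi * r\<^sup>2))"
  define E where "E = (\<lambda>m r. exp (- (real m * s r) * sigma2) * laplace W I (real m * s r))"
  define G where "G = (\<lambda>r. \<Sum>m = 1..n. (- 1) ^ (m + 1) * real (n choose m) * E m r)"
  have s_nonneg: "0 \<le> s r" for r
    using assms by (simp add: s_def eta_def)
  have s_mono: "s r \<le> s t" if "0 \<le> r" "r \<le> t" for r t
    unfolding s_def using that assms by (intro mult_left_mono powr_mono2) (auto simp: eta_def)
  \<comment> \<open>Both factors of \<open>E m\<close> are nonnegative and decreasing in
    \<open>r\<close>; the resulting integrability permits exchanging the sum over \<open>m\<close>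
    with the integral.\<close>
  have "E m t \<le> E m r" if "0 \<le> r" "r \<le> t" for m r t
    unfolding E_def using assms s_mono[OF that] s_nonneg
    by (intro mult_mono laplace_antimono)
      (auto intro!: mult_left_mono mult_right_mono integral_nonneg_AE
        simp: laplace_eq laplace_kernel_bounds)
  then have int: "set_integrable lborel {0..D} (\<lambda>r. f p r * E m r)" for p m
    by (intro set_integrable_continuous_mult_antimono)
      (auto simp: monotone_on_def f_def intro!: continuous_intros)
  have G: "G r = (\<integral>\<omega>. 1 - (1 - exp (- s r * sigma2) * laplace_kernel (s r) (I \<omega>)) ^ n \<partial>W)" for r
    unfolding G_def E_def using assms s_nonneg by (intro alternating_laplace_sum) auto
  have "concave_on UNIV (\<lambda>p. LINT r:{0..D}|lborel. f p r * G r)"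
    unfolding f_def
  proof (rule concave_on_rayleigh_integral)
    show "antimono_on {0..D} G"
      unfolding monotone_on_def G using assms s_nonneg s_mono
      by (intro ballI impI outage_complement_antimono) auto
    show "0 \<le> G D"
      unfolding G using assms s_nonneg by (intro outage_complement_nonneg)
  qed fact
  moreover have "(LINT r:{0..D}|lborel. f p r * G r)
      = (\<Sum>m = 1..n. (- 1) ^ (m + 1) * real (n choose m) * (LINT r:{0..D}|lborel. f p r * E m r))" for p
  proof -
    have "indicator {0..D} r *\<^sub>R (f p r * G r) = (\<Sum>m = 1..n. (- 1) ^ (m + 1) *
        real (n choose m) * (indicator {0..D} r *\<^sub>R (f p r * E m r)))" for r
      by (simp add: G_def sum_distrib_left mult_ac)
    then show ?thesis
      using int by (simp add: set_lebesgue_integral_def set_integrable_def)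
  qed
  ultimately have "concave_on UNIV (\<lambda>p. \<Sum>i\<in>UNIV. q $ i * (\<Sum>m = 1..n. (- 1) ^ (m + 1) *
      real (n choose m) * (LINT r:{0..D}|lborel. f (p $ i) r * E m r)))"
    using q by (intro concave_on_sum_components) auto
  also have "(\<lambda>p. \<Sum>i\<in>UNIV. q $ i * (\<Sum>m = 1..n. (- 1) ^ (m + 1) *
      real (n choose m) * (LINT r:{0..D}|lborel. f (p $ i) r * E m r)))
      = objective M L lam D P \<beta> sigma2 \<alpha>\<^sub>i (laplace W I) q"
    by (simp add: objective_def fun_eq_iff n_def f_def E_def s_def mult_ac)
  finally show ?thesis .
qed

theorem theorem3:
  fixes W :: "'w measure"
    and M N\<^sub>c L :: nat
    and lam lam_p D P \<beta> sigma2 dg \<alpha>\<^sub>i \<alpha>\<^sub>o :: real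
    and q :: "real ^ 'n::{finite,linorder}"
    and Parents :: "'w \<Rightarrow> plane set"
    and X :: "nat \<Rightarrow> 'w \<Rightarrow> plane"
    and Cl A :: "nat \<Rightarrow> 'w \<Rightarrow> plane set"
    and Y :: "nat \<Rightarrow> nat \<Rightarrow> 'w \<Rightarrow> plane"
    and H :: "nat \<Rightarrow> nat \<Rightarrow> 'w \<Rightarrow> real"
  assumes "M \<ge> 1" and "N\<^sub>c \<ge> 1" and "CARD('n) > N\<^sub>c"
    and "lam > 0" and "lam_p > 0" and "D > 0" and "P > 0" and "\<beta> > 0"
    and "sigma2 \<ge> 0" and "dg \<ge> 0"
    and "0 < \<alpha>\<^sub>i" and "\<alpha>\<^sub>i < \<alpha>\<^sub>o"
    and "\<And>i j. i \<le> j \<Longrightarrow> q $ j \<le> q $ i" and "\<And>i. q $ i \<ge> 0" and "(\<Sum>i\<in>UNIV. q $ i) = 1"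
    and "L = num_serving M lam D"
    and "out_of_cloud W M lam lam_p D dg Parents X Cl A Y H"
  shows "concave_program
           (objective M L lam D P \<beta> sigma2 \<alpha>\<^sub>i (laplace W (interference P \<alpha>\<^sub>o A Y H)) q)
           (feasible_set N\<^sub>c)"
proof -
  interpret out_of_cloud W M lam lam_p D dg Parents X Cl A Y H by fact
  show ?thesis
    unfolding concave_program_def using assms
    by (intro conjI concave_on_objective polyhedron_feasible_set prob_space_axioms
        interference_measurable) auto
qed

end
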